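(* For every formula $\varphi$ of the logic $\mathcal{L}$: if $\models \varphi$, then $\vdash \varphi$.
   Context: Fix a countable set $\mathcal{AP}$ of atomic propositions. A weighted transition system (WTS) is a triple $\mathcal{M}=(S,\rightarrow,\ell)$ where $S$ is a non-empty set of states (of arbitrary cardinality), $\rightarrow\subseteq S\times\mathbb{R}_{\ge 0}\times S$ is a transition relation (write $s\xrightarrow{r}t$ for $(s,r,t)\in\rightarrow$), and $\ell:S\to 2^{\mathcal{AP}}$ is a labeling. For $s\in S$ and $T\subseteq S$ let $\theta(s)(T)=\{r\in\mathbb{R}_{\ge0}\mid \exists t\in T,\ s\xrightarrow{r}t\}$; let $\theta^-(s)(T)=-\infty$ if $\theta(s)(T)=\emptyset$ and $\inf\theta(s)(T)$ otherwise, and $\theta^+(s)(T)=\infty$ if $\theta(s)(T)=\emptyset$ and $\sup\theta(s)(T)$ otherwise. Formulae of $\mathcal{L}$: $\varphi,\psi::= p\mid\neg\varphi\mid\varphi\wedge\psi\mid L_r\varphi\mid M_r\varphi$ with $p\in\mathcal{AP}$, $r\in\mathbb{Q}_{\ge0}$; $\bot,\vee,\to,\leftrightarrow$ are defined as usual. Semantics: $\mathcal{M},s\models p$ iff $p\in\ell(s)$; Boolean cases as usual; $\mathcal{M},s\models L_r\varphi$ iff $\theta^-(s)([\![\varphi]\!])\ge r$; $\mathcal{M},s\models M_r\varphi$ iff $\theta^+(s)([\![\varphi]\!])\le r$, where $[\![\varphi]\!]=\{s\in S\mid \mathcal{M},s\models\varphi\}$. A formula is satisfiable if it holds at some state of some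 WTS; $\models\varphi$ ($\varphi$ is valid) means $\neg\varphi$ is not satisfiable. Axiomatic system: $\vdash\varphi$ means $\varphi$ belongs to the smallest set of formulae containing all instances of propositional tautologies and of the axioms below, and closed under modus ponens and the rules below (all $r,q\in\mathbb{Q}_{\ge0}$): (A1) $\neg L_0\bot$; (A2) $L_{r+q}\varphi\to L_r\varphi$ if $q>0$; (A2$'$) $M_r\varphi\to M_{r+q}\varphi$ if $q>0$; (A3) $L_r\varphi\wedge L_q\psi\to L_{\min\{r,q\}}(\varphi\vee\psi)$; (A3$'$) $M_r\varphi\wedge M_q\psi\to M_{\max\{r,q\}}(\varphi\vee\psi)$; (A4) $L_r(\varphi\vee\psi)\to L_r\varphi\vee L_r\psi$; (A5) $\neg L_0\psi\to(L_r\varphi\to L_r(\varphi\vee\psi))$; (A5$'$) $\neg L_0\psi\to(M_r\varphi\to M_r(\varphi\vee\psi))$; (A6) $L_{r+q}\varphi\to\neg M_r\varphi$ if $q>0$; (A7) $M_r\varphi\to L_0\varphi$; (R1) from $\vdash\varphi\to\psi$ infer $\vdash(L_r\psi\wedge L_0\varphi)\to L_r\varphi$; (R1$'$) from $\vdash\varphi\to\psi$ infer $\vdash(M_r\psi\wedge L_0\varphi)\to M_r\varphi$; (R2) from $\vdash\varphi\to\psi$ infer $\vdash L_0\varphi\to L_0\psi$. *)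

theory Defs
  imports Complex_Main "HOL-Library.Extended_Real" "HOL-Library.Countable"
begin

section \<open>Non-negative rationals\<close>

typedef nnrat = "{q :: rat. 0 \<le> q}"
  morphisms rat_of_nnrat nnrat_of_rat
  by (intro exI [of _ 0]) simp

setup_lifting type_definition_nnrat

instantiation nnrat :: "{linorder, comm_monoid_add}"
begin

lift_definition zero_nnrat :: nnrat is 0 by simp
lift_definition plus_nnrat :: "nnrat \<Rightarrow> nnrat \<Rightarrow> nnrat" is "(+)" by simp
lift_definition less_eq_nnrat :: "nnrat \<Rightarrow> nnrat \<Rightarrow> bool" is "(\<le>)" .
lift_definition less_nnrat :: "nnrat \<Rightarrow> nnrat \<Rightarrow> bool" is "(<)" .

instance
  by standard (transfer; auto simp: add.assoc add.commute)+

end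

definition real_of_nnrat :: "nnrat \<Rightarrow> real" where
  "real_of_nnrat r = real_of_rat (rat_of_nnrat r)"


section \<open>Weighted transition systems\<close>

record ('s, 'p) wts =
  states :: "'s set"
  trans  :: "('s \<times> real \<times> 's) set"
  label  :: "'s \<Rightarrow> 'p set"

definition is_wts :: "('s, 'p) wts \<Rightarrow> bool" where
  "is_wts M \<longleftrightarrow> states M \<noteq> {} \<and> trans M \<subseteq> states M \<times> {0..} \<times> states M"

definition theta :: "('s, 'p) wts \<Rightarrow> 's \<Rightarrow> 's set \<Rightarrow> real set" where
  "theta M s T = {r. \<exists>t\<in>T. (s, r, t) \<in> trans M}"

text \<open>
  The convention for the empty set is the opposite of the one for \<open>Inf\<close> and \<open>Sup\<close> on
  extended reals: neither bound operator holds when there is no transition into \<open>T\<close>.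
\<close>

definition theta_minus :: "('s, 'p) wts \<Rightarrow> 's \<Rightarrow> 's set \<Rightarrow> ereal" where
  "theta_minus M s T = (if theta M s T = {} then -\<infinity> else (INF r\<in>theta M s T. ereal r))"

definition theta_plus :: "('s, 'p) wts \<Rightarrow> 's \<Rightarrow> 's set \<Rightarrow> ereal" where
  "theta_plus M s T = (if theta M s T = {} then \<infinity> else (SUP r\<in>theta M s T. ereal r))"


section \<open>Formulae and semantics\<close>

datatype 'p form =
    Atom 'p
  | Neg "'p form"
  | Conj "'p form" "'p form"
  | LB nnrat "'p form"
  | MB nnrat "'p form"

text \<open>
  Falsity is \<open>p \<and> \<not> p\<close> for one arbitrary but fixed atom \<open>p\<close>, here \<open>undefined\<close>.
\<close>

abbreviation Bot :: "'p form" where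
  "Bot \<equiv> Conj (Atom undefined) (Neg (Atom undefined))"

abbreviation Disj :: "'p form \<Rightarrow> 'p form \<Rightarrow> 'p form" where
  "Disj \<phi> \<psi> \<equiv> Neg (Conj (Neg \<phi>) (Neg \<psi>))"

abbreviation Imp :: "'p form \<Rightarrow> 'p form \<Rightarrow> 'p form" where
  "Imp \<phi> \<psi> \<equiv> Neg (Conj \<phi> (Neg \<psi>))"

primrec sat :: "('s, 'p) wts \<Rightarrow> 's \<Rightarrow> 'p form \<Rightarrow> bool" where
  "sat M s (Atom p) \<longleftrightarrow> p \<in> label M s"
| "sat M s (Neg \<phi>) \<longleftrightarrow> \<not> sat M s \<phi>"
| "sat M s (Conj \<phi> \<psi>) \<longleftrightarrow> sat M s \<phi> \<and> sat M s \<psi>"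
| "sat M s (LB r \<phi>) \<longleftrightarrow> theta_minus M s {t \<in> states M. sat M t \<phi>} \<ge> ereal (real_of_nnrat r)"
| "sat M s (MB r \<phi>) \<longleftrightarrow> theta_plus M s {t \<in> states M. sat M t \<phi>} \<le> ereal (real_of_nnrat r)"

text \<open>
  HOL cannot quantify over types inside a formula, so satisfiability and validity take the type
  \<open>'s\<close> from which states are drawn as a parameter; the carrier \<open>states M\<close> is any non-empty subset
  of it. Lemma \<open>satisfiable_any_universe\<close> below shows that a formula satisfiable over any type
  whatsoever, of whatever cardinality, is satisfiable over every infinite type, so that the choice
  of an infinite \<open>'s\<close> is immaterial.
\<close>

definition satisfiable :: "'s itself \<Rightarrow> 'p form \<Rightarrow> bool" where
  "satisfiable (_ :: 's itself) \<phi> \<longleftrightarrow>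
     (\<exists>(M :: ('s, 'p) wts) s. is_wts M \<and> s \<in> states M \<and> sat M s \<phi>)"

definition valid :: "'s itself \<Rightarrow> 'p form \<Rightarrow> bool" where
  "valid U \<phi> \<longleftrightarrow> \<not> satisfiable U (Neg \<phi>)"


section \<open>Axiomatic system\<close>

text \<open>
  An instance of a propositional tautology is a formula that is true under every truth assignment
  \<open>v\<close> to its propositionally prime subformulae (atoms and formulae headed by \<open>LB\<close> or \<open>MB\<close>).
\<close>

primrec prop_eval :: "('p form \<Rightarrow> bool) \<Rightarrow> 'p form \<Rightarrow> bool" where
  "prop_eval v (Atom p) \<longleftrightarrow> v (Atom p)"
| "prop_eval v (Neg \<phi>) \<longleftrightarrow> \<not> prop_eval v \<phi>"
| "prop_eval v (Conj \<phi> \<psi>) \<longleftrightarrow> prop_eval v \<phi> \<and> prop_eval v \<psi>"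
| "prop_eval v (LB r \<phi>) \<longleftrightarrow> v (LB r \<phi>)"
| "prop_eval v (MB r \<phi>) \<longleftrightarrow> v (MB r \<phi>)"

definition tautology :: "'p form \<Rightarrow> bool" where
  "tautology \<phi> \<longleftrightarrow> (\<forall>v. prop_eval v \<phi>)"

inductive prov :: "'p form \<Rightarrow> bool" (\<open>\<turnstile> _\<close> [50] 50) where
  Taut: "tautology \<phi> \<Longrightarrow> \<turnstile> \<phi>"
| A1:   "\<turnstile> Neg (LB 0 Bot)"
| A2:   "q > 0 \<Longrightarrow> \<turnstile> Imp (LB (r + q) \<phi>) (LB r \<phi>)"
| A2':  "q > 0 \<Longrightarrow> \<turnstile> Imp (MB r \<phi>) (MB (r + q) \<phi>)"
| A3:   "\<turnstile> Imp (Conj (LB r \<phi>) (LB q \<psi>)) (LB (min r q) (Disj \<phi> \<psi>))"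
| A3':  "\<turnstile> Imp (Conj (MB r \<phi>) (MB q \<psi>)) (MB (max r q) (Disj \<phi> \<psi>))"
| A4:   "\<turnstile> Imp (LB r (Disj \<phi> \<psi>)) (Disj (LB r \<phi>) (LB r \<psi>))"
| A5:   "\<turnstile> Imp (Neg (LB 0 \<psi>)) (Imp (LB r \<phi>) (LB r (Disj \<phi> \<psi>)))"
| A5':  "\<turnstile> Imp (Neg (LB 0 \<psi>)) (Imp (MB r \<phi>) (MB r (Disj \<phi> \<psi>)))"
| A6:   "q > 0 \<Longrightarrow> \<turnstile> Imp (LB (r + q) \<phi>) (Neg (MB r \<phi>))"
| A7:   "\<turnstile> Imp (MB r \<phi>) (LB 0 \<phi>)"
| MP:   "\<turnstile> Imp \<phi> \<psi> \<Longrightarrow> \<turnstile> \<phi> \<Longrightarrow> \<turnstile> \<psi>"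
| R1:   "\<turnstile> Imp \<phi> \<psi> \<Longrightarrow> \<turnstile> Imp (Conj (LB r \<psi>) (LB 0 \<phi>)) (LB r \<phi>)"
| R1':  "\<turnstile> Imp \<phi> \<psi> \<Longrightarrow> \<turnstile> Imp (Conj (MB r \<psi>) (LB 0 \<phi>)) (MB r \<phi>)"
| R2:   "\<turnstile> Imp \<phi> \<psi> \<Longrightarrow> \<turnstile> Imp (LB 0 \<phi>) (LB 0 \<psi>)"


section \<open>Independence of the universe of states\<close>

primrec subf :: "'p form \<Rightarrow> 'p form set" where
  "subf (Atom p) = {Atom p}"
| "subf (Neg \<phi>) = insert (Neg \<phi>) (subf \<phi>)"
| "subf (Conj \<phi> \<psi>) = insert (Conj \<phi> \<psi>) (subf \<phi> \<union> subf \<psi>)"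
| "subf (LB r \<phi>) = insert (LB r \<phi>) (subf \<phi>)"
| "subf (MB r \<phi>) = insert (MB r \<phi>) (subf \<phi>)"

lemma finite_subf: "finite (subf \<phi>)"
  by (induction \<phi>) auto

lemma subf_refl: "\<phi> \<in> subf \<phi>"
  by (cases \<phi>) auto

lemma satisfiable_any_universe:
  fixes \<phi> :: "'p form"
  assumes "satisfiable TYPE('t) \<phi>" and inf: "infinite (UNIV :: 's set)"
  shows "satisfiable TYPE('s) \<phi>"
proof -
  obtain M :: "('t, 'p) wts" and s0 where M: "is_wts M" "s0 \<in> states M" "sat M s0 \<phi>"
    using assms(1) unfolding satisfiable_def by blast
  define h where "h s = {\<psi> \<in> subf \<phi>. sat M s \<psi>}" for s
  have "h ` states M \<subseteq> Pow (subf \<phi>)"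
    by (auto simp: h_def)
  then have fin: "finite (h ` states M)"
    using finite_subf finite_subset by blast
  obtain B :: "'s set" where B: "finite B" "card B = card (h ` states M)"
    using inf by (meson infinite_arbitrarily_large)
  then obtain f :: "'p form set \<Rightarrow> 's" where f: "bij_betw f (h ` states M) B"
    using fin by (metis finite_same_card_bij)
  define g where "g s = f (h s)" for s
  define rep where "rep u = (SOME s. s \<in> states M \<and> g s = u)" for u
  have rep: "rep (g s) \<in> states M \<and> h (rep (g s)) = h s" if "s \<in> states M" for s
  proof -
    have "rep (g s) \<in> states M \<and> g (rep (g s)) = g s"
      unfolding rep_def by (rule someI [of _ s]) (simp add: that)
    then show ?thesis
      using f that unfolding g_def bij_betw_def inj_on_def by blast
  qed
  define N :: "('s, 'p) wts" where
    "N = \<lparr>states = g ` states M,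
          trans = {(u, r, v). u \<in> g ` states M \<and>
                     (\<exists>t\<in>states M. (rep u, r, t) \<in> trans M \<and> v = g t)},
          label = (\<lambda>u. label M (rep u))\<rparr>"
  have wtsN: "is_wts N"
    using M unfolding is_wts_def N_def by auto
  have eqv: "sat M (rep (g s)) \<psi> = sat M s \<psi>" if "s \<in> states M" "\<psi> \<in> subf \<phi>" for s \<psi>
    using rep [OF that(1)] that(2) unfolding h_def by blast
  have th: "theta N (g s) {u \<in> states N. sat N u \<psi>} = theta M (rep (g s)) {t \<in> states M. sat M t \<psi>}"
    if "s \<in> states M" and "\<And>t. t \<in> states M \<Longrightarrow> sat N (g t) \<psi> = sat M t \<psi>" for s \<psi>
  proof -
    have st: "states N = g ` states M"
      by (simp add: N_def)
    have tr: "(g s, r, v) \<in> trans N \<longleftrightarrow> (\<exists>t\<in>states M. (rep (g s), r, t) \<in> trans M \<and> v = g t)" for r v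
      using that(1) by (simp add: N_def)
    show ?thesis
      unfolding theta_def tr st using that(2) by (auto; metis)
  qed
  have main: "subf \<psi> \<subseteq> subf \<phi> \<Longrightarrow> s \<in> states M \<Longrightarrow> sat N (g s) \<psi> = sat M s \<psi>" for \<psi> s
  proof (induction \<psi> arbitrary: s)
    case (Atom p)
    then show ?case using eqv [of s "Atom p"] by (simp add: N_def)
  next
    case (Neg \<psi>)
    then show ?case by simp
  next
    case (Conj \<psi>1 \<psi>2)
    then show ?case by simp
  next
    case (LB r \<psi>)
    have "sat N (g t) \<psi> = sat M t \<psi>" if "t \<in> states M" for t
      using LB that by simp
    then have "theta_minus N (g s) {u \<in> states N. sat N u \<psi>} =
               theta_minus M (rep (g s)) {t \<in> states M. sat M t \<psi>}"
      using th [OF LB.prems(2)] by (simp add: theta_minus_def)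
    with eqv [OF LB.prems(2), of "LB r \<psi>"] LB.prems(1) show ?case
      by simp
  next
    case (MB r \<psi>)
    have "sat N (g t) \<psi> = sat M t \<psi>" if "t \<in> states M" for t
      using MB that by simp
    then have "theta_plus N (g s) {u \<in> states N. sat N u \<psi>} =
               theta_plus M (rep (g s)) {t \<in> states M. sat M t \<psi>}"
      using th [OF MB.prems(2)] by (simp add: theta_plus_def)
    with eqv [OF MB.prems(2), of "MB r \<psi>"] MB.prems(1) show ?case
      by simp
  qed
  from main [OF order_refl M(2)] have "sat N (g s0) \<phi>"
    using M(3) by simp
  moreover have "g s0 \<in> states N"
    using M by (simp add: N_def)
  ultimately show ?thesis
    using wtsN unfolding satisfiable_def by blast
qed

end

theory Submission
  imports Defs
begin

text \<open>
  The countermodel of a non-theorem \<open>\<phi>\<close> lives on the maximal consistent sets. The logic is not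
  compact (\<open>L\<^sub>q p\<close> for all \<open>q < r\<close> entails \<open>L\<^sub>r p\<close>), so a maximal consistent set need not describe a
  state in full; weights are therefore only required to respect the finitely many indices
  occurring in \<open>\<phi>\<close>. Two maximal consistent sets that agree on the subformulae of \<open>\<phi>\<close> are
  treated alike as targets, and each such class is defined by one characteristic formula \<open>\<chi>\<close>.
  From \<open>\<Gamma>\<close> into the class of \<open>\<chi>\<close> there is a transition for every weight permitted by the
  formulae \<open>L\<^sub>r \<chi>\<close> and \<open>M\<^sub>r \<chi>\<close> in \<open>\<Gamma>\<close>, provided \<open>L\<^sub>0 \<chi>\<close> is in \<open>\<Gamma>\<close>. Since a subformula is
  equivalent to the disjunction of the characteristic formulae below it, the axioms reduce
  \<open>L\<^sub>r \<psi>\<close> and \<open>M\<^sub>r \<psi>\<close> to the corresponding formulae for those \<open>\<chi>\<close>.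
\<close>

section \<open>Maximal consistent sets\<close>

text \<open>Theories replace derivations from premises. Closure under modus ponens alone suffices,
  since R1, R1' and R2 apply to theorems only.\<close>

definition deductive :: "'p form set \<Rightarrow> bool" where
  "deductive F \<longleftrightarrow> (\<forall>\<phi>. \<turnstile> \<phi> \<longrightarrow> \<phi> \<in> F) \<and> (\<forall>\<phi> \<psi>. Imp \<phi> \<psi> \<in> F \<longrightarrow> \<phi> \<in> F \<longrightarrow> \<psi> \<in> F)"

definition mcs :: "'p form set \<Rightarrow> bool" where
  "mcs \<Gamma> \<longleftrightarrow> deductive \<Gamma> \<and> Bot \<notin> \<Gamma> \<and> (\<forall>\<phi>. \<phi> \<in> \<Gamma> \<or> Neg \<phi> \<in> \<Gamma>)"

lemma deductive_prov: "deductive F \<Longrightarrow> \<turnstile> \<phi> \<Longrightarrow> \<phi> \<in> F"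
  by (simp add: deductive_def)

lemma deductive_mp: "deductive F \<Longrightarrow> Imp \<phi> \<psi> \<in> F \<Longrightarrow> \<phi> \<in> F \<Longrightarrow> \<psi> \<in> F"
  unfolding deductive_def by blast

lemma deductive_prov_mp: "deductive F \<Longrightarrow> \<turnstile> Imp \<phi> \<psi> \<Longrightarrow> \<phi> \<in> F \<Longrightarrow> \<psi> \<in> F"
  using deductive_prov deductive_mp by blast

lemma deductive_theorems: "deductive {\<phi>. \<turnstile> \<phi>}"
  by (auto simp: deductive_def intro: MP)

text \<open>A form of the deduction theorem: the consequents of \<phi> in F serve as the theory
  generated by \<phi> over F. The two tautologies are the combinators K and S.\<close>

lemma deductive_extend:
  assumes "deductive F"
  shows "deductive {\<psi>. Imp \<phi> \<psi> \<in> F}"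
  unfolding deductive_def
proof (intro conjI allI impI; unfold mem_Collect_eq)
  fix \<psi> :: "'a form" assume "\<turnstile> \<psi>"
  moreover have "\<turnstile> Imp \<psi> (Imp \<phi> \<psi>)"
    by (rule Taut) (simp add: tautology_def)
  ultimately show "Imp \<phi> \<psi> \<in> F"
    using MP deductive_prov [OF assms] by blast
next
  fix \<psi> \<chi> assume *: "Imp \<phi> (Imp \<psi> \<chi>) \<in> F" "Imp \<phi> \<psi> \<in> F"
  have "\<turnstile> Imp (Imp \<phi> (Imp \<psi> \<chi>)) (Imp (Imp \<phi> \<psi>) (Imp \<phi> \<chi>))"
    by (rule Taut) (auto simp: tautology_def)
  with * show "Imp \<phi> \<chi> \<in> F"
    using deductive_prov_mp [OF assms] deductive_mp [OF assms] by blast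
qed

lemma deductive_extend_supset:
  assumes "deductive F"
  shows "insert \<phi> F \<subseteq> {\<psi>. Imp \<phi> \<psi> \<in> F}"
proof -
  have "\<turnstile> Imp \<phi> \<phi>" and "\<turnstile> Imp \<psi> (Imp \<phi> \<psi>)" for \<psi>
    by (rule Taut, simp add: tautology_def)+
  then show ?thesis
    using deductive_prov [OF assms] deductive_prov_mp [OF assms] by blast
qed

text \<open>In a chain the two premises of modus ponens lie in one common member. This gives the
  upper bounds for Zorn's lemma.\<close>

lemma deductive_Union_chain:
  assumes "C \<noteq> {}" and chain: "\<And>F G. F \<in> C \<Longrightarrow> G \<in> C \<Longrightarrow> F \<subseteq> G \<or> G \<subseteq> F"
    and ded: "\<And>F. F \<in> C \<Longrightarrow> deductive F"
  shows "deductive (\<Union>C)"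
  unfolding deductive_def
proof (intro conjI allI impI)
  fix \<phi> :: "'a form" assume "\<turnstile> \<phi>"
  then show "\<phi> \<in> \<Union>C"
    using assms(1) deductive_prov [OF ded] by (metis UnionI ex_in_conv)
next
  fix \<phi> \<psi> assume "Imp \<phi> \<psi> \<in> \<Union>C" "\<phi> \<in> \<Union>C"
  then obtain F G where "F \<in> C" "Imp \<phi> \<psi> \<in> F" "G \<in> C" "\<phi> \<in> G"
    by blast
  then obtain H where H: "H \<in> C" "Imp \<phi> \<psi> \<in> H" "\<phi> \<in> H"
    using chain [of F G] by blast
  with deductive_mp [OF ded [OF H(1)] H(2,3)] show "\<psi> \<in> \<Union>C"
    by blast
qed

lemma lindenbaum:
  assumes F: "deductive F" "Bot \<notin> F"
  obtains \<Gamma> where "mcs \<Gamma>" "F \<subseteq> \<Gamma>"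
proof -
  let ?A = "{G. deductive G \<and> Bot \<notin> G \<and> F \<subseteq> G}"
  have "\<exists>\<Gamma>\<in>?A. \<forall>X\<in>?A. \<Gamma> \<subseteq> X \<longrightarrow> X = \<Gamma>"
  proof (rule subset_Zorn_nonempty)
    have "F \<in> ?A" using F by simp
    then show "?A \<noteq> {}" by (metis empty_iff)
  next
    fix C assume C: "C \<noteq> {}" "subset.chain ?A C"
    then have *: "deductive G \<and> Bot \<notin> G \<and> F \<subseteq> G" if "G \<in> C" for G
      using that unfolding subset_chain_def by blast
    have "deductive (\<Union>C)"
      using C(1)
    proof (rule deductive_Union_chain)
      show "G \<subseteq> H \<or> H \<subseteq> G" if "G \<in> C" "H \<in> C" for G H
        using C(2) that unfolding subset_chain_def by blast
    qed (use * in blast)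
    moreover have "F \<subseteq> \<Union>C"
      using C(1) * by blast
    ultimately show "\<Union>C \<in> ?A"
      using * by simp
  qed
  then obtain \<Gamma> where "\<Gamma> \<in> ?A" and max: "\<And>X. X \<in> ?A \<Longrightarrow> \<Gamma> \<subseteq> X \<Longrightarrow> X = \<Gamma>"
    by (elim bexE) simp
  then have \<Gamma>: "deductive \<Gamma>" "Bot \<notin> \<Gamma>" "F \<subseteq> \<Gamma>"
    by simp_all
  have "Neg \<phi> \<in> \<Gamma>" if "\<phi> \<notin> \<Gamma>" for \<phi>
  proof -
    let ?X = "{\<psi>. Imp \<phi> \<psi> \<in> \<Gamma>}"
    have X: "insert \<phi> \<Gamma> \<subseteq> ?X"
      by (rule deductive_extend_supset [OF \<Gamma>(1)])
    \<comment> \<open>If adding \<phi> were consistent, maximality would make the extension equal to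
      \<Gamma>, which lacks \<phi>.\<close>
    have "Bot \<in> ?X"
    proof (rule ccontr)
      assume "Bot \<notin> ?X"
      then have "?X = \<Gamma>"
        using X \<Gamma>(3) deductive_extend [OF \<Gamma>(1)] by (intro max) auto
      then show False
        using X that by blast
    qed
    moreover have "\<turnstile> Imp (Imp \<phi> Bot) (Neg \<phi>)"
      by (rule Taut) (simp add: tautology_def)
    ultimately show ?thesis
      using deductive_prov_mp [OF \<Gamma>(1)] by simp
  qed
  then have "mcs \<Gamma>"
    using \<Gamma> unfolding mcs_def by blast
  then show thesis using \<Gamma>(3) by (rule that)
qed

lemma mcs_prov: "mcs \<Gamma> \<Longrightarrow> \<turnstile> \<phi> \<Longrightarrow> \<phi> \<in> \<Gamma>"
  unfolding mcs_def using deductive_prov by blast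

lemma mcs_prov_mp: "mcs \<Gamma> \<Longrightarrow> \<turnstile> Imp \<phi> \<psi> \<Longrightarrow> \<phi> \<in> \<Gamma> \<Longrightarrow> \<psi> \<in> \<Gamma>"
  unfolding mcs_def using deductive_prov_mp by blast

lemma mcs_mp: "mcs \<Gamma> \<Longrightarrow> Imp \<phi> \<psi> \<in> \<Gamma> \<Longrightarrow> \<phi> \<in> \<Gamma> \<Longrightarrow> \<psi> \<in> \<Gamma>"
  unfolding mcs_def using deductive_mp by blast

lemma mcs_Neg:
  assumes "mcs \<Gamma>"
  shows "Neg \<phi> \<in> \<Gamma> \<longleftrightarrow> \<phi> \<notin> \<Gamma>"
proof -
  have "\<turnstile> Imp \<phi> (Imp (Neg \<phi>) Bot)"
    by (rule Taut) (simp add: tautology_def)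
  then show ?thesis
    using assms mcs_prov_mp mcs_mp unfolding mcs_def by blast
qed

lemma mcs_Conj:
  assumes "mcs \<Gamma>"
  shows "Conj \<phi> \<psi> \<in> \<Gamma> \<longleftrightarrow> \<phi> \<in> \<Gamma> \<and> \<psi> \<in> \<Gamma>"
proof -
  have "\<turnstile> Imp \<phi> (Imp \<psi> (Conj \<phi> \<psi>))" "\<turnstile> Imp (Conj \<phi> \<psi>) \<phi>" "\<turnstile> Imp (Conj \<phi> \<psi>) \<psi>"
    by (rule Taut, simp add: tautology_def)+
  then show ?thesis
    using assms mcs_prov_mp mcs_mp by blast
qed

lemmas mcs_simps = mcs_Neg mcs_Conj

text \<open>An unprovable \<phi> leaves the theory generated by \<open>Neg \<phi>\<close>
  consistent, so Lindenbaum applies. Propositional derivations thus become membership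
  arguments.\<close>

lemma prov_iff_mcs: "\<turnstile> \<phi> \<longleftrightarrow> (\<forall>\<Gamma>. mcs \<Gamma> \<longrightarrow> \<phi> \<in> \<Gamma>)"
proof (intro iffI allI impI)
  assume all: "\<forall>\<Gamma>. mcs \<Gamma> \<longrightarrow> \<phi> \<in> \<Gamma>"
  let ?F = "{\<psi>. Imp (Neg \<phi>) \<psi> \<in> {\<psi>. \<turnstile> \<psi>}}"
  have F: "deductive ?F"
    by (rule deductive_extend [OF deductive_theorems])
  have "Neg \<phi> \<in> ?F"
    using deductive_extend_supset [OF deductive_theorems] by (rule subsetD) simp
  have "Bot \<in> ?F"
  proof (rule ccontr)
    assume "Bot \<notin> ?F"
    then obtain \<Gamma> where "mcs \<Gamma>" "?F \<subseteq> \<Gamma>"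
      using lindenbaum [OF F] by blast
    then show False
      using \<open>Neg \<phi> \<in> ?F\<close> all mcs_Neg by blast
  qed
  moreover have "\<turnstile> Imp (Imp (Neg \<phi>) Bot) \<phi>"
    by (rule Taut) (simp add: tautology_def)
  ultimately show "\<turnstile> \<phi>"
    using MP by blast
qed (rule mcs_prov)

lemma prov_Imp_iff_mcs: "\<turnstile> Imp \<phi> \<psi> \<longleftrightarrow> (\<forall>\<Gamma>. mcs \<Gamma> \<longrightarrow> \<phi> \<in> \<Gamma> \<longrightarrow> \<psi> \<in> \<Gamma>)"
  by (auto simp: prov_iff_mcs mcs_simps)

section \<open>Bounds in maximal consistent sets\<close>

text \<open>Both operators obey the same laws for implication and, at equal indices, for
  disjunction, so the reduction to disjuncts is proved once.\<close>

definition bounding :: "('p form \<Rightarrow> 'p form) \<Rightarrow> bool" where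
  "bounding B \<longleftrightarrow> (\<exists>r. B = LB r \<or> B = MB r)"

lemma bounding_LB: "bounding (LB r)" and bounding_MB: "bounding (MB r)"
  by (auto simp: bounding_def)

text \<open>Translates the form \<open>r + q\<close> with \<open>q > 0\<close> of A2, A2' and A6
  into the order.\<close>

lemma nnrat_le_iff_add: "r \<le> q \<longleftrightarrow> r = q \<or> (\<exists>d>0. q = r + d)" for r q :: nnrat
proof transfer
  fix r q :: rat assume "0 \<le> r" "0 \<le> q"
  have "q - r \<in> {q. 0 \<le> q}" "0 < q - r" "q = r + (q - r)" if "r < q"
    using that by simp_all
  then show "r \<le> q \<longleftrightarrow> r = q \<or> (\<exists>d\<in>{q. 0 \<le> q}. 0 < d \<and> q = r + d)"
    unfolding le_less by (metis less_add_same_cancel1)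
qed

lemma nnrat_zero_le: "0 \<le> r" for r :: nnrat
  by transfer simp

lemma mcs_LB_mono:
  assumes "mcs \<Gamma>" "LB q \<phi> \<in> \<Gamma>" "r \<le> q"
  shows "LB r \<phi> \<in> \<Gamma>"
  using assms A2 mcs_prov_mp unfolding nnrat_le_iff_add by blast

lemma mcs_MB_mono:
  assumes "mcs \<Gamma>" "MB r \<phi> \<in> \<Gamma>" "r \<le> q"
  shows "MB q \<phi> \<in> \<Gamma>"
  using assms A2' mcs_prov_mp unfolding nnrat_le_iff_add by blast

text \<open>A consequence of A6; it later keeps the interval of admissible weights from being
  empty.\<close>

lemma mcs_LB_le_MB:
  assumes "mcs \<Gamma>" "LB r \<phi> \<in> \<Gamma>" "MB q \<phi> \<in> \<Gamma>"
  shows "r \<le> q"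
proof (rule ccontr)
  assume "\<not> r \<le> q"
  then obtain d where "d > 0" "r = q + d"
    using nnrat_le_iff_add [of q r] by auto
  then have "Neg (MB q \<phi>) \<in> \<Gamma>"
    using A6 assms mcs_prov_mp by blast
  then show False
    using assms mcs_Neg by blast
qed

section \<open>Bounds on finite disjunctions\<close>

context
  fixes \<Gamma> :: "'p form set"
  assumes mcs: "mcs \<Gamma>"
begin

lemma LB0_mono: "\<turnstile> Imp \<phi> \<psi> \<Longrightarrow> LB 0 \<phi> \<in> \<Gamma> \<Longrightarrow> LB 0 \<psi> \<in> \<Gamma>"
  using R2 mcs_prov_mp [OF mcs] by blast

lemma bounding_LB0: "bounding B \<Longrightarrow> B \<phi> \<in> \<Gamma> \<Longrightarrow> LB 0 \<phi> \<in> \<Gamma>"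
  unfolding bounding_def
  using mcs_LB_mono [OF mcs _ nnrat_zero_le] A7 mcs_prov_mp [OF mcs] by blast

text \<open>Fewer targets mean fewer weights, so bounds persist; \<open>LB 0 \<phi>\<close> excludes
  the empty set of weights, where no bound holds.\<close>

lemma bounding_antimono:
  "bounding B \<Longrightarrow> \<turnstile> Imp \<phi> \<psi> \<Longrightarrow> B \<psi> \<in> \<Gamma> \<Longrightarrow> LB 0 \<phi> \<in> \<Gamma> \<Longrightarrow> B \<phi> \<in> \<Gamma>"
  unfolding bounding_def
  using R1 R1' mcs_prov_mp [OF mcs] mcs_Conj [OF mcs] by blast

lemma bounding_cong:
  assumes "bounding B" "\<And>\<Delta>. mcs \<Delta> \<Longrightarrow> \<phi> \<in> \<Delta> \<longleftrightarrow> \<psi> \<in> \<Delta>" "B \<phi> \<in> \<Gamma>"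
  shows "B \<psi> \<in> \<Gamma>"
proof -
  have "\<turnstile> Imp \<phi> \<psi>" "\<turnstile> Imp \<psi> \<phi>"
    using assms(2) by (simp_all add: prov_Imp_iff_mcs)
  then show ?thesis
    using assms LB0_mono bounding_LB0 bounding_antimono by blast
qed

lemma bounding_Disj:
  assumes "bounding B" "B \<phi> \<in> \<Gamma>" "B \<psi> \<in> \<Gamma>"
  shows "B (Disj \<phi> \<psi>) \<in> \<Gamma>"
  using assms A3 [of _ \<phi> _ \<psi>] A3' [of _ \<phi> _ \<psi>] mcs_prov_mp [OF mcs] mcs_Conj [OF mcs]
  unfolding bounding_def by (metis min.idem max.idem)

lemma bounding_Disj1:
  assumes "bounding B" "B \<phi> \<in> \<Gamma>" "LB 0 \<psi> \<notin> \<Gamma>"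
  shows "B (Disj \<phi> \<psi>) \<in> \<Gamma>"
  using assms A5 A5' mcs_prov_mp [OF mcs] mcs_mp [OF mcs] mcs_Neg [OF mcs]
  unfolding bounding_def by metis

text \<open>A5 and A5' add the unreachable disjunct only on the right; congruence swaps the two
  sides.\<close>

lemma bounding_Disj2:
  assumes "bounding B" "B \<psi> \<in> \<Gamma>" "LB 0 \<phi> \<notin> \<Gamma>"
  shows "B (Disj \<phi> \<psi>) \<in> \<Gamma>"
  using bounding_Disj1 [OF assms]
  by (rule bounding_cong [OF assms(1), rotated]) (auto simp: mcs_simps)

abbreviation Disjs :: "'p form list \<Rightarrow> 'p form" where
  "Disjs xs \<equiv> foldr Disj xs Bot"

lemma mcs_Disjs: "mcs \<Delta> \<Longrightarrow> Disjs xs \<in> \<Delta> \<longleftrightarrow> (\<exists>\<chi>\<in>set xs. \<chi> \<in> \<Delta>)"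
  by (induction xs) (auto simp: mcs_simps)

lemma LB0_DisjsD: "LB 0 (Disjs xs) \<in> \<Gamma> \<Longrightarrow> \<exists>\<chi>\<in>set xs. LB 0 \<chi> \<in> \<Gamma>"
proof (induction xs)
  case Nil
  then show ?case
    using A1 mcs_prov [OF mcs] mcs_Neg [OF mcs] by auto
next
  case (Cons \<chi> xs)
  then have "Disj (LB 0 \<chi>) (LB 0 (Disjs xs)) \<in> \<Gamma>"
    using mcs_prov_mp [OF mcs A4] by simp
  then show ?case
    using Cons.IH by (auto simp: mcs_simps mcs)
qed

lemma bounding_Disjs:
  assumes B: "bounding B"
  shows "\<lbrakk>\<exists>\<chi>\<in>set xs. LB 0 \<chi> \<in> \<Gamma>; \<And>\<chi>. \<chi> \<in> set xs \<Longrightarrow> LB 0 \<chi> \<in> \<Gamma> \<Longrightarrow> B \<chi> \<in> \<Gamma>\<rbrakk>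
    \<Longrightarrow> B (Disjs xs) \<in> \<Gamma>"
proof (induction xs)
  case Nil
  then show ?case by simp
next
  case (Cons \<chi> xs)
  have IH: "B (Disjs xs) \<in> \<Gamma>" if "\<exists>\<chi>\<in>set xs. LB 0 \<chi> \<in> \<Gamma>"
    using Cons that by simp
  have "B (Disj \<chi> (Disjs xs)) \<in> \<Gamma>"
  proof (cases "LB 0 \<chi> \<in> \<Gamma>")
    case True
    then have "B \<chi> \<in> \<Gamma>"
      using Cons.prems by simp
    \<comment> \<open>If the tail has a reachable disjunct, IH and A3 or A3' apply. Otherwise
      \<open>LB0_DisjsD\<close> makes the whole tail unreachable, and A5 or A5' applies.\<close>
    then show ?thesis
      using IH LB0_DisjsD bounding_Disj [OF B] bounding_Disj1 [OF B] by blast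
  next
    case False
    then show ?thesis
      using IH Cons.prems(1) bounding_Disj2 [OF B] by auto
  qed
  then show ?case by simp
qed

text \<open>The syntactic counterpart of bounding a finite union of weight sets: some part is
  nonempty, and each nonempty part obeys the bound.\<close>

lemma bounding_iff_disjuncts:
  assumes B: "bounding B" and X: "finite X"
    and \<phi>: "\<And>\<Delta>. mcs \<Delta> \<Longrightarrow> \<phi> \<in> \<Delta> \<longleftrightarrow> (\<exists>\<chi>\<in>X. \<chi> \<in> \<Delta>)"
  shows "B \<phi> \<in> \<Gamma> \<longleftrightarrow> (\<exists>\<chi>\<in>X. LB 0 \<chi> \<in> \<Gamma>) \<and> (\<forall>\<chi>\<in>X. LB 0 \<chi> \<in> \<Gamma> \<longrightarrow> B \<chi> \<in> \<Gamma>)"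
proof -
  obtain xs where xs: "set xs = X"
    using X finite_list by blast
  have eqv: "\<phi> \<in> \<Delta> \<longleftrightarrow> Disjs xs \<in> \<Delta>" if "mcs \<Delta>" for \<Delta>
    using \<phi> [OF that] mcs_Disjs [OF that] xs by simp
  have "B \<phi> \<in> \<Gamma> \<longleftrightarrow> B (Disjs xs) \<in> \<Gamma>"
    using eqv bounding_cong [OF B] by blast
  moreover have "\<exists>\<chi>\<in>X. LB 0 \<chi> \<in> \<Gamma>" if "B (Disjs xs) \<in> \<Gamma>"
    using that bounding_LB0 [OF B] LB0_DisjsD xs by blast
  moreover have "B \<chi> \<in> \<Gamma>" if "B \<phi> \<in> \<Gamma>" "\<chi> \<in> X" "LB 0 \<chi> \<in> \<Gamma>" for \<chi>
    using that \<phi> bounding_antimono [OF B, of \<chi> \<phi>] by (auto simp: prov_Imp_iff_mcs)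
  ultimately show ?thesis
    using bounding_Disjs [OF B, of xs] xs by blast
qed

end

section \<open>Characteristic formulae\<close>

text \<open>Choice avoids enumerating C. As A enters only through \<open>A \<inter> C\<close>, sets
  agreeing on C receive the very same formula, not merely an equivalent one.\<close>

definition char_form :: "'p form set \<Rightarrow> 'p form set \<Rightarrow> 'p form" where
  "char_form C A = (SOME \<chi>. \<forall>\<Gamma>. mcs \<Gamma> \<longrightarrow> (\<chi> \<in> \<Gamma> \<longleftrightarrow> \<Gamma> \<inter> C = A \<inter> C))"

lemma mcs_char_form:
  assumes "finite C" "mcs \<Gamma>"
  shows "char_form C A \<in> \<Gamma> \<longleftrightarrow> \<Gamma> \<inter> C = A \<inter> C"
proof -
  have "\<exists>\<chi>. \<forall>\<Gamma>. mcs \<Gamma> \<longrightarrow> (\<chi> \<in> \<Gamma> \<longleftrightarrow> \<Gamma> \<inter> C = A \<inter> C)"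
    using assms(1)
  proof (induction C)
    case empty
    have "\<forall>\<Gamma>. mcs \<Gamma> \<longrightarrow> (Neg Bot \<in> \<Gamma> \<longleftrightarrow> \<Gamma> \<inter> {} = A \<inter> {})"
      by (simp add: mcs_simps)
    then show ?case by blast
  next
    case (insert \<phi> C)
    then obtain \<chi> where \<chi>: "\<forall>\<Gamma>. mcs \<Gamma> \<longrightarrow> (\<chi> \<in> \<Gamma> \<longleftrightarrow> \<Gamma> \<inter> C = A \<inter> C)"
      by blast
    have "\<forall>\<Gamma>. mcs \<Gamma> \<longrightarrow>
        (Conj (if \<phi> \<in> A then \<phi> else Neg \<phi>) \<chi> \<in> \<Gamma> \<longleftrightarrow> \<Gamma> \<inter> insert \<phi> C = A \<inter> insert \<phi> C)"
      using \<chi> insert.hyps(2) by (auto simp: mcs_simps)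
    then show ?case by blast
  qed
  then show ?thesis
    unfolding char_form_def by (rule someI2_ex) (use assms(2) in blast)
qed

lemma char_form_Int: "char_form C (A \<inter> C) = char_form C A"
  by (simp add: char_form_def Int_assoc)

lemma bounding_iff_char_forms:
  assumes "mcs \<Gamma>" "bounding B" "finite C" "\<phi> \<in> C"
  shows "B \<phi> \<in> \<Gamma> \<longleftrightarrow>
    (\<exists>\<Delta>. mcs \<Delta> \<and> \<phi> \<in> \<Delta> \<and> LB 0 (char_form C \<Delta>) \<in> \<Gamma>) \<and>
    (\<forall>\<Delta>. mcs \<Delta> \<longrightarrow> \<phi> \<in> \<Delta> \<longrightarrow> LB 0 (char_form C \<Delta>) \<in> \<Gamma> \<longrightarrow> B (char_form C \<Delta>) \<in> \<Gamma>)"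
proof -
  let ?X = "char_form C ` {\<Delta>. mcs \<Delta> \<and> \<phi> \<in> \<Delta>}"
  \<comment> \<open>Although there may be infinitely many maximal consistent sets, only their traces
    on C matter, so the disjunction is finite.\<close>
  have "?X \<subseteq> char_form C ` Pow C"
    using char_form_Int [of C] by (metis (no_types, lifting) Int_lower2 PowI image_eqI image_subsetI)
  then have "finite ?X"
    using assms(3) by (meson finite_Pow_iff finite_imageI finite_subset)
  moreover have "\<phi> \<in> \<Delta> \<longleftrightarrow> (\<exists>\<chi>\<in>?X. \<chi> \<in> \<Delta>)" if "mcs \<Delta>" for \<Delta>
    using assms(4) that by (auto simp: mcs_char_form [OF assms(3)])
  ultimately show ?thesis
    using bounding_iff_disjuncts [OF assms(1,2)] by auto
qed

section \<open>The canonical model for finitely many indices\<close>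

text \<open>An interval of weights. The condition \<open>LB 0 \<chi> \<in> \<Gamma>\<close>,
  independent of w, empties it when \<chi> is unreachable.\<close>

definition admissible :: "nnrat set \<Rightarrow> 'p form set \<Rightarrow> 'p form \<Rightarrow> real set" where
  "admissible R \<Gamma> \<chi> = {w. 0 \<le> w \<and> LB 0 \<chi> \<in> \<Gamma> \<and>
    (\<forall>r\<in>R. (LB r \<chi> \<in> \<Gamma> \<longrightarrow> real_of_nnrat r \<le> w) \<and> (MB r \<chi> \<in> \<Gamma> \<longrightarrow> w \<le> real_of_nnrat r))}"

lemma real_of_nnrat_le_iff: "real_of_nnrat r \<le> real_of_nnrat q \<longleftrightarrow> r \<le> q"
  by (simp add: real_of_nnrat_def of_rat_less_eq less_eq_nnrat.rep_eq)

lemma real_of_nnrat_nonneg: "0 \<le> real_of_nnrat r"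
  using rat_of_nnrat [of r] by (simp add: real_of_nnrat_def)

text \<open>The witness is the left endpoint: the greatest lower bound index in R, or 0. By
  monotonicity every r with \<open>LB r \<chi>\<close> missing lies strictly above it.\<close>

lemma admissible_below:
  assumes mcs: "mcs \<Gamma>" and "LB 0 \<chi> \<in> \<Gamma>" "finite R"
  shows "\<exists>w\<in>admissible R \<Gamma> \<chi>. \<forall>r. LB r \<chi> \<notin> \<Gamma> \<longrightarrow> w < real_of_nnrat r"
proof -
  \<comment> \<open>Inserting 0 keeps the set nonempty, and
    \<open>LB 0 \<chi> \<in> \<Gamma>\<close> justifies it as a lower bound.\<close>
  let ?S = "insert 0 {r \<in> R. LB r \<chi> \<in> \<Gamma>}"
  define m where "m = Max ?S"
  have m: "finite ?S" "LB m \<chi> \<in> \<Gamma>"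
    using assms Max_in [of ?S] unfolding m_def by auto
  have "real_of_nnrat m \<in> admissible R \<Gamma> \<chi>"
    using m assms(2) mcs_LB_le_MB [OF mcs m(2)] Max_ge [OF m(1)]
    by (auto simp: admissible_def real_of_nnrat_nonneg real_of_nnrat_le_iff m_def)
  moreover have "m < r" if "LB r \<chi> \<notin> \<Gamma>" for r
    using mcs_LB_mono [OF mcs m(2)] that not_le by blast
  ultimately show ?thesis
    using real_of_nnrat_le_iff not_le by metis
qed

lemma admissible_above:
  assumes mcs: "mcs \<Gamma>" and "LB 0 \<chi> \<in> \<Gamma>" "finite R" "r \<in> R" "MB r \<chi> \<notin> \<Gamma>"
  shows "\<exists>w\<in>admissible R \<Gamma> \<chi>. real_of_nnrat r < w"
proof (cases "{r \<in> R. MB r \<chi> \<in> \<Gamma>} = {}")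
  case True
  \<comment> \<open>No index in R bounds the weights from above, so any weight beyond all of R is
    admissible; the added 1 makes it strictly larger than r.\<close>
  let ?w = "real_of_nnrat (Max R) + 1"
  have "real_of_nnrat q < ?w" if "q \<in> R" for q
    using Max_ge [OF assms(3) that] real_of_nnrat_le_iff [of q "Max R"] by linarith
  moreover have "0 \<le> ?w"
    using real_of_nnrat_nonneg [of "Max R"] by simp
  ultimately show ?thesis
    using True assms by (intro bexI [of _ ?w]) (auto simp: admissible_def intro: less_imp_le)
next
  case False
  let ?S = "{r \<in> R. MB r \<chi> \<in> \<Gamma>}"
  \<comment> \<open>The right endpoint of the interval, attained because R is finite.\<close>
  define m where "m = Min ?S"
  have m: "finite ?S" "MB m \<chi> \<in> \<Gamma>"
    using assms False Min_in [of ?S] unfolding m_def by auto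
  have "real_of_nnrat m \<in> admissible R \<Gamma> \<chi>"
    using m assms(2) mcs_LB_le_MB [OF mcs _ m(2)] Min_le [OF m(1)]
    by (auto simp: admissible_def real_of_nnrat_nonneg real_of_nnrat_le_iff m_def)
  moreover have "r < m"
    using mcs_MB_mono [OF mcs m(2)] assms(5) not_le by blast
  ultimately show ?thesis
    using real_of_nnrat_le_iff not_le by metis
qed

definition canonical :: "nnrat set \<Rightarrow> 'p form set \<Rightarrow> ('p form set, 'p) wts" where
  "canonical R C = \<lparr>states = {\<Gamma>. mcs \<Gamma>},
     trans = {(\<Gamma>, w, \<Delta>). mcs \<Gamma> \<and> mcs \<Delta> \<and> w \<in> admissible R \<Gamma> (char_form C \<Delta>)},
     label = (\<lambda>\<Gamma>. {p. Atom p \<in> \<Gamma>})\<rparr>"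

lemma theta_canonical:
  assumes "mcs \<Gamma>"
  shows "theta (canonical R C) \<Gamma> {\<Delta> \<in> states (canonical R C). P \<Delta>} =
    (\<Union>\<Delta>\<in>{\<Delta>. mcs \<Delta> \<and> P \<Delta>}. admissible R \<Gamma> (char_form C \<Delta>))"
  using assms by (auto simp: theta_def canonical_def)

text \<open>With x finite, the value at the empty set falsifies the comparison; hence the
  nonemptiness conjunct, here and for \<open>theta_plus\<close>.\<close>

lemma theta_minus_ge_iff:
  "ereal x \<le> theta_minus M s T \<longleftrightarrow> theta M s T \<noteq> {} \<and> (\<forall>w\<in>theta M s T. x \<le> w)"
  by (simp add: theta_minus_def le_INF_iff)

lemma theta_plus_le_iff:
  "theta_plus M s T \<le> ereal x \<longleftrightarrow> theta M s T \<noteq> {} \<and> (\<forall>w\<in>theta M s T. w \<le> x)"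
  by (simp add: theta_plus_def SUP_le_iff)

text \<open>In the cases \<open>LB\<close> and \<open>MB\<close> the semantic condition, split over
  the target sets, matches \<open>bounding_iff_char_forms\<close> clause by clause.\<close>

lemma truth:
  assumes C: "finite C" and R: "finite R"
    and sub: "\<And>\<psi>. \<psi> \<in> C \<Longrightarrow> subf \<psi> \<subseteq> C"
    and idx: "\<And>r \<psi>. LB r \<psi> \<in> C \<or> MB r \<psi> \<in> C \<Longrightarrow> r \<in> R"
  shows "\<phi> \<in> C \<Longrightarrow> mcs \<Gamma> \<Longrightarrow> sat (canonical R C) \<Gamma> \<phi> \<longleftrightarrow> \<phi> \<in> \<Gamma>"
proof (induction \<phi> arbitrary: \<Gamma>)
  case (Atom p)
  then show ?case by (simp add: canonical_def)
next
  case (Neg \<phi>)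
  then show ?case
    using sub [OF Neg.prems(1)] subf_refl [of \<phi>] by (auto simp: mcs_simps)
next
  case (Conj \<phi> \<psi>)
  then show ?case
    using sub [OF Conj.prems(1)] subf_refl [of \<phi>] subf_refl [of \<psi>] by (auto simp: mcs_simps)
next
  case (LB r \<phi>)
  have \<phi>: "\<phi> \<in> C" and r: "r \<in> R"
    using sub [OF LB.prems(1)] subf_refl [of \<phi>] idx LB.prems(1) by auto
  let ?\<chi> = "char_form C"
  have "theta (canonical R C) \<Gamma> {\<Delta> \<in> states (canonical R C). sat (canonical R C) \<Delta> \<phi>} =
      (\<Union>\<Delta>\<in>{\<Delta>. mcs \<Delta> \<and> \<phi> \<in> \<Delta>}. admissible R \<Gamma> (?\<chi> \<Delta>))"
    unfolding theta_canonical [OF LB.prems(2)] using LB.IH [OF \<phi>] by auto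
  then have "sat (canonical R C) \<Gamma> (LB r \<phi>) \<longleftrightarrow>
      (\<exists>\<Delta>. mcs \<Delta> \<and> \<phi> \<in> \<Delta> \<and> admissible R \<Gamma> (?\<chi> \<Delta>) \<noteq> {}) \<and>
      (\<forall>\<Delta>. mcs \<Delta> \<longrightarrow> \<phi> \<in> \<Delta> \<longrightarrow> (\<forall>w\<in>admissible R \<Gamma> (?\<chi> \<Delta>). real_of_nnrat r \<le> w))"
    by (auto simp: theta_minus_ge_iff)
  moreover have "admissible R \<Gamma> \<chi> \<noteq> {} \<longleftrightarrow> LB 0 \<chi> \<in> \<Gamma>" for \<chi>
    using admissible_below [OF LB.prems(2) _ R, of \<chi>] by (auto simp: admissible_def)
  \<comment> \<open>If \<open>LB r \<chi>\<close> is missing, the left endpoint lies below r; if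
    present, \<open>r \<in> R\<close> makes it a constraint on every admissible weight.\<close>
  moreover have "(\<forall>w\<in>admissible R \<Gamma> \<chi>. real_of_nnrat r \<le> w) \<longleftrightarrow>
      (LB 0 \<chi> \<in> \<Gamma> \<longrightarrow> LB r \<chi> \<in> \<Gamma>)" for \<chi>
    using admissible_below [OF LB.prems(2) _ R, of \<chi>] r
    by (force simp: admissible_def not_le [symmetric])
  ultimately show ?case
    using bounding_iff_char_forms [OF LB.prems(2) bounding_LB C \<phi>] by simp
next
  case (MB r \<phi>)
  have \<phi>: "\<phi> \<in> C" and r: "r \<in> R"
    using sub [OF MB.prems(1)] subf_refl [of \<phi>] idx MB.prems(1) by auto
  let ?\<chi> = "char_form C"
  have "theta (canonical R C) \<Gamma> {\<Delta> \<in> states (canonical R C). sat (canonical R C) \<Delta> \<phi>} =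
      (\<Union>\<Delta>\<in>{\<Delta>. mcs \<Delta> \<and> \<phi> \<in> \<Delta>}. admissible R \<Gamma> (?\<chi> \<Delta>))"
    unfolding theta_canonical [OF MB.prems(2)] using MB.IH [OF \<phi>] by auto
  then have "sat (canonical R C) \<Gamma> (MB r \<phi>) \<longleftrightarrow>
      (\<exists>\<Delta>. mcs \<Delta> \<and> \<phi> \<in> \<Delta> \<and> admissible R \<Gamma> (?\<chi> \<Delta>) \<noteq> {}) \<and>
      (\<forall>\<Delta>. mcs \<Delta> \<longrightarrow> \<phi> \<in> \<Delta> \<longrightarrow> (\<forall>w\<in>admissible R \<Gamma> (?\<chi> \<Delta>). w \<le> real_of_nnrat r))"
    by (auto simp: theta_plus_le_iff)
  moreover have "admissible R \<Gamma> \<chi> \<noteq> {} \<longleftrightarrow> LB 0 \<chi> \<in> \<Gamma>" for \<chi>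
    using admissible_below [OF MB.prems(2) _ R, of \<chi>] by (auto simp: admissible_def)
  \<comment> \<open>Here the interval may be unbounded, so \<open>admissible_above\<close> supplies
    a weight beyond r.\<close>
  moreover have "(\<forall>w\<in>admissible R \<Gamma> \<chi>. w \<le> real_of_nnrat r) \<longleftrightarrow>
      (LB 0 \<chi> \<in> \<Gamma> \<longrightarrow> MB r \<chi> \<in> \<Gamma>)" for \<chi>
    using admissible_above [OF MB.prems(2) _ R r, of \<chi>] r
    by (force simp: admissible_def not_le [symmetric])
  ultimately show ?case
    using bounding_iff_char_forms [OF MB.prems(2) bounding_MB C \<phi>] by simp
qed

section \<open>From the truth lemma to completeness\<close>

lemma subf_trans: "\<psi> \<in> subf \<phi> \<Longrightarrow> subf \<psi> \<subseteq> subf \<phi>"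
  by (induction \<phi>) auto

lemma mcs_satisfiable:
  fixes \<phi> :: "'p form"
  assumes "mcs \<Gamma>" "\<phi> \<in> \<Gamma>"
  shows "satisfiable TYPE('p form set) \<phi>"
proof -
  \<comment> \<open>The default 0 merely adds one index to R, which stays finite.\<close>
  define idx where "idx \<psi> = (case \<psi> of LB r _ \<Rightarrow> r | MB r _ \<Rightarrow> r | _ \<Rightarrow> 0)" for \<psi> :: "'p form"
  let ?R = "idx ` subf \<phi>" and ?C = "subf \<phi>"
  have "sat (canonical ?R ?C) \<Gamma> \<phi>"
    using assms truth [of ?C ?R \<phi> \<Gamma>] finite_subf [of \<phi>] subf_trans subf_refl [of \<phi>]
    by (force simp: idx_def)
  moreover have "is_wts (canonical ?R ?C)"
    using assms(1) by (auto simp: is_wts_def canonical_def admissible_def)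
  moreover have "\<Gamma> \<in> states (canonical ?R ?C)"
    using assms(1) by (simp add: canonical_def)
  ultimately show ?thesis
    unfolding satisfiable_def by blast
qed

theorem theorem4p10:
  fixes \<phi> :: "'p::countable form"
  assumes "infinite (UNIV :: 's set)"
    and "valid TYPE('s) \<phi>"
  shows "\<turnstile> \<phi>"
proof (rule ccontr)
  assume "\<not> \<turnstile> \<phi>"
  then obtain \<Gamma> where "mcs \<Gamma>" "Neg \<phi> \<in> \<Gamma>"
    by (auto simp: prov_iff_mcs mcs_Neg)
  \<comment> \<open>The canonical model lives on \<open>'p form set\<close>; its finite quotient by
    subformulae moves it into the given infinite type.\<close>
  then have "satisfiable TYPE('s) (Neg \<phi>)"
    using mcs_satisfiable satisfiable_any_universe assms(1) by blast
  then show False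
    using assms(2) by (simp add: valid_def)
qed

end
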